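(* For all integers $k\ge 1$ and $N\ge 1$, $$\sup_{\pi\in\Pi} R(\pi,N)\le \log(k+1).$$ Moreover, when $k>1$, this inequality is strict.
   Context: Setting. $\log$ is the logarithm to base 2. Let $k\ge 1$, $N\ge1$ be integers. $\theta=(\theta_1,\dots,\theta_k)$ is a random vector in $\mathbb R^k$ whose coordinates are i.i.d. with Lebesgue density $f_0$ on $\mathbb R$, so $\theta$ has density $p_0(u)=\prod_{i=1}^k f_0(u_i)$; the differential entropy $H_0=H(p_0)$ is assumed finite, where for a density $p$ on $\mathbb R^k$, $H(p)=-\int_{\mathbb R^k} p(u)\log p(u)\,du$. $Z$ is uniform on $[0,1]$ and independent of $\theta$. Policies. A policy is a sequence $\pi=(\pi_1,\dots,\pi_N)$ where $\pi_n$ is a Borel subset of $[0,1]\times\{0,1,\dots,k\}^{n-1}\times\mathbb R$; $\Pi$ is the set of all policies (adaptive policies). Under $\pi$, the question sets and answers are defined recursively for $n=1,\dots,N$ by $A_n=\{t\in\mathbb R:(Z,X_1,\dots,X_{n-1},t)\in\pi_n\}$ and $X_n=\mathbb 1_{A_n}(\theta_1)+\dots+\mathbb 1_{A_n}(\theta_k)$. Posterior and rate. $p_n$ is the conditional (posterior) density of $\theta$ given the history $B_n=(Z,A_1,\dots,A_n,X_1,\dots,X_n)$: $p_n(u)$ is proportional to $p_0(u)$ on the set $\{u\in\mathbb R^k: X_m=\sum_{i=1}^k\mathbb 1_{A_m}(u_i),\ 1\le m\le n\}$ and is $0$ outside. $H(p_N)$ is thus a random variable. The rate of reduction in expected entropy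 is $R(\pi,N)=\frac{H_0-E^\pi[H(p_N)]}{N}$, with $E^\pi$ the expectation under policy $\pi$. *)

theory Defs
  imports "HOL-Probability.Probability"
begin

text \<open>
  A point of \<open>\<real>\<^sup>k\<close> is an extensional function on \<open>{1..k}\<close>, and Lebesgue measure on \<open>\<real>\<^sup>k\<close> is
  the \<open>k\<close>-fold product of \<^const>\<open>lborel\<close>.
\<close>

definition diff_entropy :: "nat \<Rightarrow> ((nat \<Rightarrow> real) \<Rightarrow> real) \<Rightarrow> real" where
  "diff_entropy k p = - (\<integral>u. p u * log 2 (p u) \<partial>(\<Pi>\<^sub>M i\<in>{1..k}. lborel))"

definition prior_density :: "(real \<Rightarrow> real) \<Rightarrow> nat \<Rightarrow> (nat \<Rightarrow> real) \<Rightarrow> real" where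
  "prior_density f0 k u = (\<Prod>i\<in>{1..k}. f0 (u i))"

text \<open>
  The history \<open>(X\<^sub>1, \<dots>, X\<^bsub>n-1\<^esub>)\<close> is an extensional function on \<open>{1..<n}\<close>. All factors below are
  second countable, so the product \<open>\<sigma>\<close>-algebra is the Borel \<open>\<sigma>\<close>-algebra of
  \<open>[0,1] \<times> {0,\<dots>,k}\<^bsup>n-1\<^esup> \<times> \<real>\<close>.
\<close>

type_synonym policy = "nat \<Rightarrow> (real \<times> (nat \<Rightarrow> nat) \<times> real) set"

definition question_space :: "nat \<Rightarrow> nat \<Rightarrow> (real \<times> (nat \<Rightarrow> nat) \<times> real) measure" where
  "question_space k n =
     restrict_space borel {0..1} \<Otimes>\<^sub>M (\<Pi>\<^sub>M m\<in>{1..<n}. count_space {0..k}) \<Otimes>\<^sub>M borel"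

definition policies :: "nat \<Rightarrow> nat \<Rightarrow> policy set" where
  "policies k N = (\<Pi>\<^sub>E n\<in>{1..N}. sets (question_space k n))"

text \<open>
  In \<open>question \<pi> z x n\<close> only the part of \<open>x\<close> on \<open>{1..<n}\<close>, i.e. the answers preceding
  question \<open>n\<close>, is used.
\<close>

definition question :: "policy \<Rightarrow> real \<Rightarrow> (nat \<Rightarrow> nat) \<Rightarrow> nat \<Rightarrow> real set" where
  "question \<pi> z x n = {t. (z, restrict x {1..<n}, t) \<in> \<pi> n}"

definition num_in :: "nat \<Rightarrow> (nat \<Rightarrow> real) \<Rightarrow> real set \<Rightarrow> nat" where
  "num_in k u A = (\<Sum>i\<in>{1..k}. indicator A (u i))"

text \<open>
  \<open>answers \<pi> k z u n\<close> is \<open>(X\<^sub>1, \<dots>, X\<^sub>n)\<close> for \<open>Z = z\<close> and \<open>\<theta> = u\<close>, as an extensional function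
  on \<open>{1..n}\<close>.
\<close>

primrec answers :: "policy \<Rightarrow> nat \<Rightarrow> real \<Rightarrow> (nat \<Rightarrow> real) \<Rightarrow> nat \<Rightarrow> (nat \<Rightarrow> nat)" where
  "answers \<pi> k z u 0 = (\<lambda>_. undefined)"
| "answers \<pi> k z u (Suc n) =
     (answers \<pi> k z u n)(Suc n := num_in k u (question \<pi> z (answers \<pi> k z u n) (Suc n)))"

definition consistent :: "policy \<Rightarrow> nat \<Rightarrow> real \<Rightarrow> (nat \<Rightarrow> nat) \<Rightarrow> nat \<Rightarrow> (nat \<Rightarrow> real) set" where
  "consistent \<pi> k z x n = {u. \<forall>m\<in>{1..n}. x m = num_in k u (question \<pi> z x m)}"

text \<open>
  The posterior density of \<open>\<theta>\<close> given the history with \<open>Z = z\<close> and answers \<open>x\<close>. The question sets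
  of the history are determined by \<open>z\<close> and \<open>x\<close>. If the normalising constant vanishes, which
  happens only for a null set of histories, the value is \<open>0\<close>.
\<close>

definition posterior_density ::
    "(real \<Rightarrow> real) \<Rightarrow> policy \<Rightarrow> nat \<Rightarrow> real \<Rightarrow> (nat \<Rightarrow> nat) \<Rightarrow> nat \<Rightarrow> (nat \<Rightarrow> real) \<Rightarrow> real" where
  "posterior_density f0 \<pi> k z x n u =
     indicator (consistent \<pi> k z x n) u * prior_density f0 k u /
     (\<integral>v. indicator (consistent \<pi> k z x n) v * prior_density f0 k v \<partial>(\<Pi>\<^sub>M i\<in>{1..k}. lborel))"

text \<open>The random variable \<open>H(p\<^sub>n)\<close>.\<close>

definition posterior_entropy ::
    "('a \<Rightarrow> real) \<Rightarrow> (nat \<Rightarrow> 'a \<Rightarrow> real) \<Rightarrow> (real \<Rightarrow> real) \<Rightarrow> policy \<Rightarrow> nat \<Rightarrow> nat \<Rightarrow> 'a \<Rightarrow> real" where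
  "posterior_entropy Z \<theta> f0 \<pi> k n \<omega> =
     diff_entropy k
       (posterior_density f0 \<pi> k (Z \<omega>) (answers \<pi> k (Z \<omega>) (\<lambda>i\<in>{1..k}. \<theta> i \<omega>) n) n)"

definition reduction_rate ::
    "'a measure \<Rightarrow> ('a \<Rightarrow> real) \<Rightarrow> (nat \<Rightarrow> 'a \<Rightarrow> real) \<Rightarrow> (real \<Rightarrow> real) \<Rightarrow> nat \<Rightarrow> policy \<Rightarrow> nat \<Rightarrow> real" where
  "reduction_rate M Z \<theta> f0 k \<pi> N =
     (diff_entropy k (prior_density f0 k) -
      prob_space.expectation M (posterior_entropy Z \<theta> f0 \<pi> k N)) / real N"

end

theory Submission
  imports Defs
begin

text \<open>
  Given \<open>Z = z\<close> the history is a function of \<open>\<theta>\<close> with at most \<open>(k + 1)\<^sup>N\<close> values, and the expected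
  posterior entropy equals \<open>H\<^sub>0\<close> minus the entropy of the answers, which is at most
  \<open>N log (k + 1)\<close>. For strictness, uniformly in the policy, it suffices to look at the first
  question. If its set has probability \<open>p\<close>, the answers \<open>k\<close> and \<open>0\<close> have probabilities \<open>p\<^sup>k\<close> and
  \<open>(1 - p)\<^sup>k\<close>, so one of them has probability at most \<open>2\<^bsup>-k\<^esup>\<close>, which for \<open>k > 1\<close> is less than the
  share \<open>1 / (k + 1)\<close> it would have under uniformly distributed answers. Gibbs' inequality turns this
  into a loss of the binary divergence between \<open>2\<^bsup>-k\<^esup>\<close> and \<open>1 / (k + 1)\<close>.
\<close>

section \<open>Divergence and Gibbs' inequality\<close>

text \<open>The Kullback-Leibler divergence, in bits, of a Bernoulli law with parameter
  \<open>a\<close> from one with parameter \<open>r\<close>.\<close>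

definition binary_divergence :: "real \<Rightarrow> real \<Rightarrow> real" where
  "binary_divergence a r = a * log 2 (a / r) + (1 - a) * log 2 ((1 - a) / (1 - r))"

text \<open>This is \<open>ln y <= y - 1\<close> at \<open>y = 1 / x\<close>. For
  \<open>x = p / q\<close>, weighted by \<open>p\<close>, it reads
  \<open>p * ln (p / q) >= p - q\<close>, and such differences cancel over probability
  weights.\<close>

lemma ln_ge_one_minus_inverse:
  fixes x :: real
  assumes "0 < x"
  shows "1 - 1 / x \<le> ln x" and "x \<noteq> 1 \<Longrightarrow> 1 - 1 / x < ln x"
proof -
  show "1 - 1 / x \<le> ln x"
    using ln_le_minus_one[of "1 / x"] assms by (simp add: ln_div)
  assume "x \<noteq> 1"
  then have "ln (1 / x) \<noteq> 1 / x - 1"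
    using ln_eq_minus_one[of "1 / x"] assms by auto
  with ln_le_minus_one[of "1 / x"] assms show "1 - 1 / x < ln x"
    by (simp add: ln_div)
qed

text \<open>The linear lower bounds for the two summands are \<open>a - r\<close> and
  \<open>r - a\<close>; they cancel, and the first is strict because \<open>a / r\<close> differs
  from 1.\<close>

lemma binary_divergence_pos:
  assumes "0 < a" "a < r" "r < 1"
  shows "0 < binary_divergence a r"
proof -
  have "a * (1 - 1 / (a / r)) < a * ln (a / r)"
    using assms by (intro mult_strict_left_mono ln_ge_one_minus_inverse) auto
  moreover have "(1 - a) * (1 - 1 / ((1 - a) / (1 - r))) \<le> (1 - a) * ln ((1 - a) / (1 - r))"
    using assms by (intro mult_left_mono ln_ge_one_minus_inverse) auto
  moreover have "a * (1 - 1 / (a / r)) = a - r"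
    and "(1 - a) * (1 - 1 / ((1 - a) / (1 - r))) = r - a"
    using assms by (simp_all add: field_simps)
  ultimately have "0 < a * ln (a / r) + (1 - a) * ln ((1 - a) / (1 - r))"
    by linarith
  then have "0 < (a * ln (a / r) + (1 - a) * ln ((1 - a) / (1 - r))) / ln 2"
    by simp
  then show ?thesis
    by (simp add: binary_divergence_def log_def add_divide_distrib)
qed

lemma binary_divergence_self: "binary_divergence a a = 0"
  by (cases "a = 0"; cases "a = 1") (auto simp: binary_divergence_def)

text \<open>Gibbs' inequality for one term, with the logarithm of \<open>p / q\<close> split so that
  \<open>p = 0\<close> is covered.\<close>

lemma gibbs_term:
  fixes p q :: real
  assumes "0 \<le> p" "0 < q"
  shows "p * ln q + p - q \<le> p * ln p"
proof (cases "p = 0")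
  case False
  then have "p * (1 - 1 / (p / q)) \<le> p * ln (p / q)"
    using assms by (intro mult_left_mono ln_ge_one_minus_inverse) auto
  then show ?thesis
    using False assms by (simp add: ln_div algebra_simps)
qed (use assms in simp)

text \<open>
  Gibbs' inequality against the weights that give the event \<open>S\<close> mass \<open>a\<close> and are uniform on
  \<open>S\<close> and on its complement.
\<close>

lemma entropy_deficit:
  fixes P :: "'x \<Rightarrow> real"
  assumes "finite X" "S \<subseteq> X" and P: "\<And>x. x \<in> X \<Longrightarrow> 0 \<le> P x" "sum P X = 1"
    and r: "r = real (card S) / real (card X)"
    and a: "0 < a" "a \<le> r" "r < 1" and PS: "sum P S \<le> a"
  shows "binary_divergence a r - log 2 (card X) \<le> (\<Sum>x\<in>X. P x * log 2 (P x))"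
proof -
  define n where "n = real (card X)"
  have n: "0 < n"
    using a r by (auto simp: n_def intro!: Nat.gr0I)
  have cS: "real (card S) = r * n"
    using n r by (simp add: n_def)
  have cC: "real (card (X - S)) = (1 - r) * n"
    using assms(1,2) cS by (simp add: card_Diff_subset finite_subset of_nat_diff card_mono n_def
      algebra_simps)
  \<comment> \<open>\<open>s / n\<close> and \<open>t / n\<close> are the reference weights of a
    point of \<open>S\<close> and of \<open>X - S\<close>; they total \<open>a\<close> and
    \<open>1 - a\<close>.\<close>
  define s where "s = a / r"
  define t where "t = (1 - a) / (1 - r)"
  have st: "0 < s" "0 < t" "s \<le> 1" "1 \<le> t"
    using a by (auto simp: s_def t_def)
  have split: "sum g X = sum g S + sum g (X - S)" for g :: "'x \<Rightarrow> real"
    using sum.subset_diff[OF assms(2,1), of g] by simp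
  define b where "b = sum P S"
  have bC: "sum P (X - S) = 1 - b"
    using split[of P] P by (simp add: b_def)
  have 1: "(\<Sum>x\<in>S. P x * ln (s / n) + P x - s / n) = b * ln (s / n) + b - a"
    using n a by (simp add: sum.distrib sum_subtractf cS b_def s_def flip: sum_distrib_right)
  have 2: "(\<Sum>x\<in>X - S. P x * ln (t / n) + P x - t / n) = (1 - b) * ln (t / n) + (1 - b) - (1 - a)"
    using n a by (simp add: sum.distrib sum_subtractf cC bC t_def flip: sum_distrib_right)
  have "(\<Sum>x\<in>S. P x * ln (s / n) + P x - s / n) \<le> (\<Sum>x\<in>S. P x * ln (P x))"
    using assms(2) st n P by (intro sum_mono gibbs_term) auto
  moreover have "(\<Sum>x\<in>X - S. P x * ln (t / n) + P x - t / n) \<le> (\<Sum>x\<in>X - S. P x * ln (P x))"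
    using st n P by (intro sum_mono gibbs_term) auto
  \<comment> \<open>The true mass of \<open>S\<close> is \<open>b <= a\<close>. Since
    \<open>s <= 1 <= t\<close>, replacing \<open>b\<close> by \<open>a\<close> only lowers
    \<open>b * ln s + (1 - b) * ln t\<close>.\<close>
  moreover have "a * (ln t - ln s) \<ge> b * (ln t - ln s)"
    using PS st by (intro mult_right_mono) (auto simp: b_def)
  ultimately have "a * ln s + (1 - a) * ln t - ln n \<le> (\<Sum>x\<in>X. P x * ln (P x))"
    unfolding 1 2 using st n by (simp add: split ln_div algebra_simps)
  then have "(a * ln s + (1 - a) * ln t - ln n) / ln 2 \<le> (\<Sum>x\<in>X. P x * ln (P x)) / ln 2"
    by (intro divide_right_mono) auto
  then show ?thesis
    by (simp add: binary_divergence_def log_def s_def t_def n_def add_divide_distrib diff_divide_distrib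
      sum_divide_distrib)
qed

text \<open>Gibbs' inequality with \<open>q = 1\<close> bounds \<open>p * ln p\<close> below by
  \<open>p - 1\<close>. The bound later dominates the mass terms uniformly in
  \<open>z\<close>.\<close>

lemma abs_mult_log_le:
  fixes p :: real
  assumes "0 \<le> p" "p \<le> 1"
  shows "\<bar>p * log 2 p\<bar> \<le> 1 / ln 2"
proof -
  have "p * ln p \<le> 0"
    using assms by (cases "p = 0") (auto intro!: mult_nonneg_nonpos)
  moreover have "- 1 \<le> p * ln p"
    using gibbs_term[of p 1] assms by simp
  ultimately have "\<bar>p * ln p\<bar> / ln 2 \<le> 1 / ln 2"
    by (intro divide_right_mono) auto
  then show ?thesis
    by (simp add: log_def abs_divide)
qed

lemma Suc_less_two_power: "2 \<le> n \<Longrightarrow> Suc n < 2 ^ n"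
  by (induction n rule: nat_induct_at_least) auto

section \<open>Answers and consistent sets\<close>

lemma num_in_le: "num_in k u A \<le> k"
proof -
  have "num_in k u A \<le> (\<Sum>i\<in>{1..k}. 1)"
    unfolding num_in_def by (intro sum_mono) (simp add: indicator_def)
  then show ?thesis by simp
qed

lemma num_in_eq_0_iff: "num_in k u A = 0 \<longleftrightarrow> (\<forall>i\<in>{1..k}. u i \<in> - A)"
  by (auto simp: num_in_def indicator_def)

lemma num_in_eq_all_iff: "num_in k u A = k \<longleftrightarrow> (\<forall>i\<in>{1..k}. u i \<in> A)"
proof -
  have "num_in k u A + num_in k u (- A) = (\<Sum>i\<in>{1..k}. 1)"
    unfolding num_in_def sum.distrib[symmetric] by (intro sum.cong) (auto simp: indicator_def)
  then have "num_in k u A = k \<longleftrightarrow> num_in k u (- A) = 0"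
    by auto
  then show ?thesis
    by (simp add: num_in_eq_0_iff)
qed

lemma question_cong:
  "(\<And>m. m \<in> {1..<n} \<Longrightarrow> x m = y m) \<Longrightarrow> question \<pi> z x n = question \<pi> z y n"
  unfolding question_def by (metis (no_types, lifting) restrict_ext)

lemma answers_in: "answers \<pi> k z u n \<in> {1..n} \<rightarrow>\<^sub>E {0..k}"
proof (induction n)
  case (Suc n)
  then show ?case
    using num_in_le by (auto simp: PiE_iff extensional_def)
qed simp

lemma answers_prefix: "m \<le> n \<Longrightarrow> i \<le> m \<Longrightarrow> answers \<pi> k z u n i = answers \<pi> k z u m i"
  by (induction n) (auto simp: le_Suc_eq)

text \<open>Question \<open>m\<close> sees only the answers before \<open>m\<close>, and these never
  change later, so the final history satisfies the recursion at every stage.\<close>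

lemma answers_step:
  assumes "m \<in> {1..n}"
  shows "answers \<pi> k z u n m = num_in k u (question \<pi> z (answers \<pi> k z u n) m)"
proof -
  obtain l where l: "m = Suc l" "Suc l \<le> n"
    using assms by (cases m) auto
  have "question \<pi> z (answers \<pi> k z u l) m = question \<pi> z (answers \<pi> k z u n) m"
    using l by (intro question_cong) (auto simp: answers_prefix[of l n])
  then show ?thesis
    using l answers_prefix[of m n m] by simp
qed

text \<open>Agreement of two histories before \<open>m\<close> makes their \<open>m\<close>-th
  questions equal, hence the \<open>m\<close>-th answers. Thus the consistent sets are the fibres of
  the answer map and partition the states.\<close>

lemma mem_consistent_iff:
  assumes "x \<in> extensional {1..n}"
  shows "u \<in> consistent \<pi> k z x n \<longleftrightarrow> answers \<pi> k z u n = x"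
proof
  assume "answers \<pi> k z u n = x"
  then show "u \<in> consistent \<pi> k z x n"
    using answers_step by (auto simp: consistent_def)
next
  assume u: "u \<in> consistent \<pi> k z x n"
  have "m \<in> {1..n} \<Longrightarrow> answers \<pi> k z u n m = x m" for m
  proof (induction m rule: less_induct)
    case (less m)
    then have "question \<pi> z (answers \<pi> k z u n) m = question \<pi> z x m"
      by (intro question_cong) auto
    with u less.prems show ?case
      by (subst answers_step) (auto simp: consistent_def)
  qed
  moreover have "answers \<pi> k z u n \<in> extensional {1..n}"
    using answers_in by (auto simp: PiE_iff)
  ultimately show "answers \<pi> k z u n = x"
    using assms by (intro extensionalityI)
qed

section \<open>Products of densities\<close>

text \<open>Both measures give a box the product of the one-dimensional masses of its sides, and
  boxes determine a finite product measure.\<close>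

lemma PiM_density_lborel:
  fixes f :: "real \<Rightarrow> real" and I :: "'i set"
  assumes [measurable]: "f \<in> borel_measurable borel" and f: "\<And>t. 0 \<le> f t"
    and "(\<integral>\<^sup>+t. ennreal (f t) \<partial>lborel) = 1" and "finite I"
  shows "(\<Pi>\<^sub>M i\<in>I. density lborel (\<lambda>t. ennreal (f t))) =
    density (\<Pi>\<^sub>M i\<in>I. lborel) (\<lambda>u. ennreal (\<Prod>i\<in>I. f (u i)))"
proof -
  interpret L: product_sigma_finite "\<lambda>_. lborel :: real measure"
    by standard
  interpret D: prob_space "density lborel (\<lambda>t. ennreal (f t))"
    using assms by (intro prob_spaceI) (simp add: emeasure_density)
  interpret D: product_sigma_finite "\<lambda>_. density lborel (\<lambda>t. ennreal (f t))"
    by standard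
  show ?thesis
  proof (rule D.PiM_eqI[symmetric])
    fix A :: "'i \<Rightarrow> real set"
    assume A: "\<And>i. i \<in> I \<Longrightarrow> A i \<in> sets (density lborel (\<lambda>t. ennreal (f t)))"
    then have [measurable]: "\<And>i. i \<in> I \<Longrightarrow> A i \<in> sets borel"
      by simp
    have "emeasure (density (\<Pi>\<^sub>M i\<in>I. lborel) (\<lambda>u. ennreal (\<Prod>i\<in>I. f (u i)))) (Pi\<^sub>E I A)
      = (\<integral>\<^sup>+u. ennreal (\<Prod>i\<in>I. f (u i)) * indicator (Pi\<^sub>E I A) u \<partial>(\<Pi>\<^sub>M i\<in>I. lborel))"
      using \<open>finite I\<close> by (intro emeasure_density) (auto intro!: sets_PiM_I_finite)
    also have "\<dots> = (\<integral>\<^sup>+u. (\<Prod>i\<in>I. ennreal (f (u i)) * indicator (A i) (u i)) \<partial>(\<Pi>\<^sub>M i\<in>I. lborel))"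
      using \<open>finite I\<close>
      by (intro nn_integral_cong)
        (auto simp: prod.distrib prod_ennreal f space_PiM PiE_iff indicator_def)
    also have "\<dots> = (\<Prod>i\<in>I. \<integral>\<^sup>+t. ennreal (f t) * indicator (A i) t \<partial>lborel)"
      using \<open>finite I\<close> by (intro L.product_nn_integral_prod) auto
    also have "\<dots> = (\<Prod>i\<in>I. emeasure (density lborel (\<lambda>t. ennreal (f t))) (A i))"
      by (intro prod.cong) (simp_all add: emeasure_density)
    finally show "emeasure (density (\<Pi>\<^sub>M i\<in>I. lborel) (\<lambda>u. ennreal (\<Prod>i\<in>I. f (u i)))) (Pi\<^sub>E I A)
      = (\<Prod>i\<in>I. emeasure (density lborel (\<lambda>t. ennreal (f t))) (A i))" .
  qed (use \<open>finite I\<close> in \<open>auto intro!: sets_PiM_cong\<close>)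
qed

section \<open>A fixed policy: prior and history masses\<close>

text \<open>Index sets keep the form \<open>{1..k}\<close> instead of starting at
  \<open>Suc 0\<close>.\<close>

declare One_nat_def [simp del]

text \<open>The underlying probability space is left out: \<theta> is represented by its law
  \<open>\<Theta>\<close>, and Z by a parameter \<open>z\<close> that is averaged only at the
  end.\<close>

locale search_policy =
  fixes f0 :: "real \<Rightarrow> real" and k N :: nat and \<pi> :: policy
  assumes k_pos: "1 \<le> k" and N_pos: "1 \<le> N"
    and f0_nonneg: "\<And>t. 0 \<le> f0 t"
    and f0_measurable [measurable]: "f0 \<in> borel_measurable borel"
    and f0_integral: "(\<integral>\<^sup>+t. ennreal (f0 t) \<partial>lborel) = 1"
    and entropy_integrable: "integrable (\<Pi>\<^sub>M i\<in>{1..k}. lborel)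
          (\<lambda>u. prior_density f0 k u * log 2 (prior_density f0 k u))"
    and policy: "\<pi> \<in> policies k N"
begin

abbreviation "L \<equiv> \<Pi>\<^sub>M i\<in>{1..k}. (lborel :: real measure)"
abbreviation "p0 \<equiv> prior_density f0 k"
abbreviation "\<Theta> \<equiv> density L (\<lambda>u. ennreal (p0 u))"
abbreviation "histories \<equiv> {1..N} \<rightarrow>\<^sub>E {0..k}"
abbreviation "C z x \<equiv> consistent \<pi> k z x N"

text \<open>The probability of answer history \<open>x\<close> given Z = \<open>z\<close>, which is
  the normalising constant of the posterior.\<close>

definition mass :: "real \<Rightarrow> (nat \<Rightarrow> nat) \<Rightarrow> real" where
  "mass z x = (\<integral>v. indicator (C z x) v * p0 v \<partial>L)"

text \<open>The integral of \<open>p0 * log 2 p0\<close> over one cell, without the minus sign of an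
  entropy.\<close>

definition partial_entropy :: "real \<Rightarrow> (nat \<Rightarrow> nat) \<Rightarrow> real" where
  "partial_entropy z x = (\<integral>v. indicator (C z x) v * (p0 v * log 2 (p0 v)) \<partial>L)"

definition history_entropy :: "real \<Rightarrow> (nat \<Rightarrow> nat) \<Rightarrow> real" where
  "history_entropy z x = diff_entropy k (posterior_density f0 \<pi> k z x N)"

sublocale L: product_sigma_finite "\<lambda>_. lborel :: real measure"
  by standard

lemma p0_nonneg: "0 \<le> p0 u"
  unfolding prior_density_def by (intro prod_nonneg f0_nonneg)

lemma p0_measurable [measurable]: "p0 \<in> borel_measurable L"
  unfolding prior_density_def by measurable

lemma PiM_prior: "(\<Pi>\<^sub>M i\<in>{1..k}. density lborel (\<lambda>t. ennreal (f0 t))) = \<Theta>"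
  using PiM_density_lborel[OF f0_measurable f0_nonneg f0_integral, of "{1..k}"]
  by (simp add: prior_density_def[abs_def])

lemma prob_space_prior: "prob_space \<Theta>"
proof -
  have "prob_space (density lborel (\<lambda>t. ennreal (f0 t)))"
    by (intro prob_spaceI) (simp add: emeasure_density f0_integral)
  then show ?thesis
    unfolding PiM_prior[symmetric] by (intro prob_space_PiM)
qed

lemma integrable_p0: "integrable L p0" and integral_p0: "(\<integral>u. p0 u \<partial>L) = 1"
proof -
  interpret prob_space \<Theta> by (rule prob_space_prior)
  have "(\<integral>\<^sup>+u. ennreal (p0 u) \<partial>L) = ennreal 1"
    using emeasure_space_1 by (simp add: emeasure_density cong: nn_integral_cong)
  then show "integrable L p0" "(\<integral>u. p0 u \<partial>L) = 1"
    by (auto simp: p0_nonneg integrable_iff_bounded integral_eq_nn_integral)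
qed

section \<open>Measurability in \<open>z\<close> and \<theta>\<close>

lemma question_sections:
  assumes m: "m \<in> {1..N}"
  shows "{(z, t). t \<in> question \<pi> z x m} \<in> sets (borel \<Otimes>\<^sub>M borel)"
proof (cases "restrict x {1..<m} \<in> {1..<m} \<rightarrow>\<^sub>E {0..k}")
  case True
  \<comment> \<open>\<open>question_space\<close> has only \<open>z\<close> in \<open>[0,1]\<close>;
    clamping \<open>z\<close> gives a measurable map on all reals, and intersecting with a strip
    removes the spurious points.\<close>
  let ?h = "\<lambda>(z::real, t::real). (max 0 (min 1 z), restrict x {1..<m}, t)"
  have \<pi>m: "\<pi> m \<in> sets (question_space k m)"
    using policy m by (auto simp: policies_def)
  have "?h \<in> borel \<Otimes>\<^sub>M borel \<rightarrow>\<^sub>M question_space k m"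
    unfolding question_space_def case_prod_beta using True
    by (intro measurable_Pair measurable_restrict_space2) (auto simp: space_PiM)
  from measurable_sets[OF this \<pi>m]
  have [measurable]: "?h -` \<pi> m \<in> sets (borel \<Otimes>\<^sub>M borel)"
    by (simp add: space_pair_measure)
  have "\<pi> m \<subseteq> {0..1} \<times> UNIV"
    using sets.sets_into_space[OF \<pi>m]
    by (auto simp: question_space_def space_pair_measure space_restrict_space)
  then have "{(z, t). t \<in> question \<pi> z x m} = ?h -` \<pi> m \<inter> ({0..1} \<times> UNIV)"
    by (force simp: question_def)
  also have "\<dots> \<in> sets (borel \<Otimes>\<^sub>M borel)"
    by measurable
  finally show ?thesis .
next
  case False
  \<comment> \<open>Here some earlier answer exceeds \<open>k\<close>, so the point lies outside
    \<open>question_space k m\<close> and the question is empty.\<close>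
  have "\<pi> m \<in> sets (question_space k m)"
    using policy m by (auto simp: policies_def)
  from sets.sets_into_space[OF this] have "restrict x {1..<m} \<in> {1..<m} \<rightarrow>\<^sub>E {0..k}"
    if "t \<in> question \<pi> z x m" for z t
  proof -
    have "(z, restrict x {1..<m}, t) \<in> space (question_space k m)"
      using that \<open>\<pi> m \<subseteq> space (question_space k m)\<close> by (auto simp: question_def)
    then show ?thesis
      by (simp add: question_space_def space_pair_measure space_PiM del: restrict_PiE)
  qed
  with False have "{(z, t). t \<in> question \<pi> z x m} = {}"
    by blast
  then show ?thesis by simp
qed

lemma question_measurable: "m \<in> {1..N} \<Longrightarrow> question \<pi> z x m \<in> sets borel"
  using sets_Pair1[OF question_sections[of m x], of z] by (simp add: vimage_def)

text \<open>Joint measurability is what makes integrals over a cell measurable functions of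
  \<open>z\<close>.\<close>

lemma sets_consistent:
  "{w \<in> space (borel \<Otimes>\<^sub>M L). snd w \<in> C (fst w) x} \<in> sets (borel \<Otimes>\<^sub>M L)"
proof -
  have "(\<lambda>w. real (num_in k (snd w) (question \<pi> (fst w) x m))) \<in> borel_measurable (borel \<Otimes>\<^sub>M L)"
    if m: "m \<in> {1..N}" for m
  proof -
    have [measurable]: "{(z, t). t \<in> question \<pi> z x m} \<in> sets (borel \<Otimes>\<^sub>M borel)"
      using m by (rule question_sections)
    have "(\<lambda>w. \<Sum>i\<in>{1..k}. indicator {(z, t). t \<in> question \<pi> z x m} (fst w, snd w i) :: real)
      \<in> borel_measurable (borel \<Otimes>\<^sub>M L)"
      by measurable
    also have "(\<lambda>w. \<Sum>i\<in>{1..k}. indicator {(z, t). t \<in> question \<pi> z x m} (fst w, snd w i) :: real)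
      = (\<lambda>w. real (num_in k (snd w) (question \<pi> (fst w) x m)))"
      by (auto simp: num_in_def indicator_def fun_eq_iff intro!: sum.cong)
    finally show ?thesis .
  qed
  then have "{w \<in> space (borel \<Otimes>\<^sub>M L). \<forall>m\<in>{1..N}.
      real (x m) = real (num_in k (snd w) (question \<pi> (fst w) x m))} \<in> sets (borel \<Otimes>\<^sub>M L)"
    by (intro sets.sets_Collect_finite_All borel_measurable_eq) auto
  then show ?thesis
    by (simp add: consistent_def)
qed

lemma indicator_consistent_pair [measurable]:
  "(\<lambda>w. indicator (C (fst w) x) (snd w) :: real) \<in> borel_measurable (borel \<Otimes>\<^sub>M L)"
  using sets_consistent by (subst measurable_cong[where g =
    "indicator {w \<in> space (borel \<Otimes>\<^sub>M L). snd w \<in> C (fst w) x}"]) (auto simp: indicator_def)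

lemma indicator_consistent [measurable]:
  "(\<lambda>v. indicator (C z x) v :: real) \<in> borel_measurable L"
  using measurable_compose[OF measurable_Pair1' indicator_consistent_pair, of z x] by simp

lemma sigma_finite_L: "sigma_finite_measure L"
  by (rule L.sigma_finite) simp

lemma mass_measurable [measurable]: "(\<lambda>z. mass z x) \<in> borel_measurable borel"
proof -
  interpret sigma_finite_measure L by (rule sigma_finite_L)
  have "(\<lambda>(z, v). indicator (C z x) v * p0 v) \<in> borel_measurable (borel \<Otimes>\<^sub>M L)"
    unfolding case_prod_beta by measurable
  then show ?thesis
    unfolding mass_def by (rule borel_measurable_lebesgue_integral)
qed

lemma partial_entropy_measurable [measurable]:
  "(\<lambda>z. partial_entropy z x) \<in> borel_measurable borel"
proof -
  interpret sigma_finite_measure L by (rule sigma_finite_L)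
  have "(\<lambda>(z, v). indicator (C z x) v * (p0 v * log 2 (p0 v))) \<in> borel_measurable (borel \<Otimes>\<^sub>M L)"
    unfolding case_prod_beta by measurable
  then show ?thesis
    unfolding partial_entropy_def by (rule borel_measurable_lebesgue_integral)
qed

lemma integrable_indicator_times:
  fixes g :: "(nat \<Rightarrow> real) \<Rightarrow> real"
  assumes "integrable L g"
  shows "integrable L (\<lambda>v. indicator (C z x) v * g v)"
proof (rule Bochner_Integration.integrable_bound[OF assms])
  have [measurable]: "g \<in> borel_measurable L"
    using assms by (rule borel_measurable_integrable)
  show "(\<lambda>v. indicator (C z x) v * g v) \<in> borel_measurable L"
    by measurable
qed (simp add: indicator_def)

section \<open>Entropy of the posterior for one history\<close>

lemma posterior_density_eq:
  "posterior_density f0 \<pi> k z x N u = indicator (C z x) u * p0 u / mass z x"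
  by (simp add: posterior_density_def mass_def)

lemma mass_nonneg: "0 \<le> mass z x"
  unfolding mass_def by (intro integral_nonneg_AE) (simp add: p0_nonneg)

lemma mass_le_1: "mass z x \<le> 1"
  unfolding mass_def integral_p0[symmetric]
  by (intro integral_mono integrable_indicator_times integrable_p0)
    (simp_all add: p0_nonneg indicator_def)

text \<open>On the cell, the logarithm of the posterior is \<open>log 2 p0\<close> minus the log of
  the mass. Multiplying by the mass includes null histories, where \<open>p0\<close> vanishes almost
  everywhere on the cell and both sides are 0.\<close>

lemma mass_times_history_entropy:
  "mass z x * history_entropy z x = mass z x * log 2 (mass z x) - partial_entropy z x"
proof (cases "mass z x = 0")
  case True
  then have "AE v in L. indicator (C z x) v * p0 v = 0"
    unfolding mass_def
    by (subst (asm) integral_nonneg_eq_0_iff_AE[OF integrable_indicator_times[OF integrable_p0]])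
      (simp_all add: p0_nonneg)
  then have "partial_entropy z x = (\<integral>v. 0 \<partial>L)"
    unfolding partial_entropy_def
    by (intro integral_cong_AE) auto
  with True show ?thesis by simp
next
  case False
  let ?P = "mass z x"
  have P: "0 < ?P"
    using False mass_nonneg[of z x] by linarith
  have "posterior_density f0 \<pi> k z x N u * log 2 (posterior_density f0 \<pi> k z x N u)
     = (indicator (C z x) u * (p0 u * log 2 (p0 u)) - log 2 ?P * (indicator (C z x) u * p0 u)) / ?P" for u
  proof (cases "u \<in> C z x \<and> p0 u \<noteq> 0")
    case True
    then have "0 < p0 u"
      using p0_nonneg[of u] by linarith
    with True P show ?thesis
      by (simp add: posterior_density_eq log_divide field_simps)
  qed (auto simp: posterior_density_eq)
  then have "history_entropy z x = - ((partial_entropy z x - log 2 ?P * ?P) / ?P)"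
    unfolding history_entropy_def diff_entropy_def
    by (simp add: integrable_indicator_times integrable_p0 entropy_integrable
      Bochner_Integration.integral_diff flip: mass_def partial_entropy_def)
  with P show ?thesis
    by (simp add: field_simps)
qed

text \<open>Follows from the explicit formula; at mass 0, division by zero makes the posterior
  density, and so its entropy, 0.\<close>

lemma history_entropy_measurable [measurable]:
  "(\<lambda>z. history_entropy z x) \<in> borel_measurable borel"
proof -
  have "history_entropy z x =
    (if mass z x = 0 then 0 else (mass z x * log 2 (mass z x) - partial_entropy z x) / mass z x)" for z
  proof (cases "mass z x = 0")
    case True
    then show ?thesis
      by (simp add: history_entropy_def diff_entropy_def posterior_density_eq)
  next
    case False
    then show ?thesis
      by (simp flip: mass_times_history_entropy)
  qed
  then show ?thesis
    by (subst measurable_cong) measurable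
qed

section \<open>Summation over histories\<close>

text \<open>Exactly one cell contains \<open>u\<close>, that of its own answers.\<close>

lemma sum_indicator_consistent:
  fixes g :: "(nat \<Rightarrow> nat) \<Rightarrow> real"
  shows "(\<Sum>x\<in>histories. indicator (C z x) u * g x) = g (answers \<pi> k z u N)"
proof -
  have "(\<Sum>x\<in>histories. indicator (C z x) u * g x) =
    (\<Sum>x\<in>histories. if answers \<pi> k z u N = x then g x else 0)"
    by (intro sum.cong) (auto simp: PiE_iff mem_consistent_iff indicator_def)
  also have "\<dots> = g (answers \<pi> k z u N)"
    using answers_in[of \<pi> k z u N] by (simp add: finite_PiE)
  finally show ?thesis .
qed

text \<open>The law of total expectation over cells. Weights \<open>c = 1\<close> give the total
  mass and entropy; an indicator weight gives the law of the first answer.\<close>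

lemma sum_integral_consistent:
  fixes g :: "(nat \<Rightarrow> real) \<Rightarrow> real" and c :: "(nat \<Rightarrow> nat) \<Rightarrow> real"
  assumes "integrable L g"
  shows "(\<Sum>x\<in>histories. c x * (\<integral>v. indicator (C z x) v * g v \<partial>L)) =
    (\<integral>v. c (answers \<pi> k z v N) * g v \<partial>L)"
proof -
  have "(\<Sum>x\<in>histories. c x * (\<integral>v. indicator (C z x) v * g v \<partial>L)) =
    (\<integral>v. (\<Sum>x\<in>histories. c x * (indicator (C z x) v * g v)) \<partial>L)"
    using assms by (subst Bochner_Integration.integral_sum) (auto intro!: integrable_indicator_times)
  also have "\<dots> = (\<integral>v. (\<Sum>x\<in>histories. indicator (C z x) v * c x) * g v \<partial>L)"
    by (simp add: sum_distrib_left sum_distrib_right mult_ac)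
  finally show ?thesis
    by (simp add: sum_indicator_consistent)
qed

lemma sum_mass: "(\<Sum>x\<in>histories. mass z x) = 1"
  using sum_integral_consistent[OF integrable_p0, of "\<lambda>_. 1" z] by (simp add: mass_def integral_p0)

lemma sum_partial_entropy: "(\<Sum>x\<in>histories. partial_entropy z x) = - diff_entropy k p0"
  using sum_integral_consistent[OF entropy_integrable, of "\<lambda>_. 1" z]
  by (simp add: partial_entropy_def diff_entropy_def)

section \<open>The first question and the entropy of the answers\<close>

lemma integrable_indicator_f0:
  assumes "B \<in> sets borel"
  shows "integrable lborel (\<lambda>t. indicator B t * f0 t)"
proof -
  have "integrable lborel f0"
    using f0_integral by (simp add: integrable_iff_bounded f0_nonneg)
  then show ?thesis
    using integrable_mult_indicator[of B lborel f0] assms by simp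
qed

lemma all_in_probability:
  assumes [measurable]: "B \<in> sets borel"
  shows "(\<integral>u. indicator {u. \<forall>i\<in>{1..k}. u i \<in> B} u * p0 u \<partial>L) = (\<integral>t. indicator B t * f0 t \<partial>lborel) ^ k"
proof -
  have "(\<integral>u. indicator {u. \<forall>i\<in>{1..k}. u i \<in> B} u * p0 u \<partial>L) =
    (\<integral>u. (\<Prod>i\<in>{1..k}. indicator B (u i) * f0 (u i)) \<partial>L)"
    by (intro Bochner_Integration.integral_cong)
      (auto simp: prod.distrib prior_density_def indicator_def)
  also have "\<dots> = (\<Prod>i\<in>{1..k}. (\<integral>t. indicator B t * f0 t \<partial>lborel))"
    by (rule L.product_integral_prod) (auto intro: integrable_indicator_f0)
  finally show ?thesis by simp
qed

lemma unlikely_first_answer: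
  obtains j where "j \<le> k" "(\<Sum>x | x \<in> histories \<and> x 1 = j. mass z x) \<le> (1 / 2) ^ k"
proof -
  \<comment> \<open>No answer precedes question 1, so restriction to \<open>{1..<1}\<close> erases
    the history; \<open>\<lambda>_. undefined\<close> is the value at which \<open>answers\<close>
    starts.\<close>
  define A where "A = question \<pi> z (\<lambda>_. undefined) 1"
  have A [measurable]: "A \<in> sets borel"
    unfolding A_def using N_pos by (intro question_measurable) auto
  have first: "answers \<pi> k z u N 1 = num_in k u A" for u
  proof -
    have "answers \<pi> k z u N 1 = answers \<pi> k z u 1 1"
      using N_pos by (intro answers_prefix) auto
    then show ?thesis by (simp add: A_def One_nat_def)
  qed
  have law: "(\<Sum>x | x \<in> histories \<and> x 1 = j. mass z x) =
    (\<integral>v. indicator {v. num_in k v A = j} v * p0 v \<partial>L)" for j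
  proof -
    have "(\<Sum>x | x \<in> histories \<and> x 1 = j. mass z x) = (\<Sum>x\<in>histories. of_bool (x 1 = j) * mass z x)"
      by (intro sum.mono_neutral_cong_left) (auto intro!: finite_PiE)
    also have "\<dots> = (\<integral>v. of_bool (answers \<pi> k z v N 1 = j) * p0 v \<partial>L)"
      unfolding mass_def by (rule sum_integral_consistent[OF integrable_p0])
    finally show ?thesis
      by (simp add: first indicator_def of_bool_def)
  qed
  have "(\<integral>t. indicator A t * f0 t \<partial>lborel) + (\<integral>t. indicator (- A) t * f0 t \<partial>lborel) =
    (\<integral>t. indicator A t * f0 t + indicator (- A) t * f0 t \<partial>lborel)"
    using A by (intro Bochner_Integration.integral_add[symmetric] integrable_indicator_f0) auto
  also have "\<dots> = (\<integral>t. f0 t \<partial>lborel)"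
    by (intro Bochner_Integration.integral_cong) (auto simp: indicator_def)
  also have "\<dots> = 1"
    using f0_integral by (simp add: integral_eq_nn_integral f0_nonneg)
  finally have sum1: "(\<integral>t. indicator A t * f0 t \<partial>lborel) + (\<integral>t. indicator (- A) t * f0 t \<partial>lborel) = 1" .
  have nonneg: "0 \<le> (\<integral>t. indicator B t * f0 t \<partial>lborel)" for B
    by (intro integral_nonneg_AE) (simp add: f0_nonneg)
  \<comment> \<open>Answer \<open>k\<close> is the unlikely one if \<open>A\<close> has probability
    at most 1/2, and answer 0 otherwise.\<close>
  show ?thesis
  proof (cases "(\<integral>t. indicator A t * f0 t \<partial>lborel) \<le> 1 / 2")
    case True
    have "(\<Sum>x | x \<in> histories \<and> x 1 = k. mass z x) \<le> (1 / 2) ^ k"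
      unfolding law num_in_eq_all_iff all_in_probability[OF A]
      using True nonneg by (rule power_mono)
    then show ?thesis
      using that by blast
  next
    case False
    have A': "- A \<in> sets borel"
      using A by auto
    have "(\<Sum>x | x \<in> histories \<and> x 1 = 0. mass z x) \<le> (1 / 2) ^ k"
      unfolding law num_in_eq_0_iff all_in_probability[OF A']
      using False sum1 nonneg by (intro power_mono) auto
    then show ?thesis
      using that by blast
  qed
qed

text \<open>Provides the condition \<open>a <= r\<close> of \<open>entropy_deficit\<close>, with
  equality possible at \<open>k = 1\<close>.\<close>

lemma half_power_le: "(1 / 2) ^ k \<le> 1 / (real k + 1)"
proof -
  have "k < 2 ^ k"
    by (rule less_exp)
  then have "real k + 1 \<le> 2 ^ k"
    by (metis Suc_leI of_nat_Suc of_nat_le_iff of_nat_numeral of_nat_power add.commute)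
  then show ?thesis
    by (simp add: power_divide frac_le)
qed

lemma mass_entropy_bound:
  "binary_divergence ((1 / 2) ^ k) (1 / (real k + 1)) - real N * log 2 (real k + 1)
    \<le> (\<Sum>x\<in>histories. mass z x * log 2 (mass z x))"
proof -
  obtain j where j: "j \<le> k" "(\<Sum>x | x \<in> histories \<and> x 1 = j. mass z x) \<le> (1 / 2) ^ k"
    by (rule unlikely_first_answer)
  have card: "card histories = (k + 1) ^ N"
    by (simp add: card_PiE Suc_eq_plus1)
  \<comment> \<open>Fixing the first answer leaves \<open>N - 1\<close> free ones, so
    \<open>S\<close> is a share \<open>1 / (k + 1)\<close> of all histories.\<close>
  have "{x. x \<in> histories \<and> x 1 = j} = (\<Pi>\<^sub>E i\<in>{1..N}. if i = 1 then {j} else {0..k})"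
    using j(1) N_pos by (auto simp: PiE_iff extensional_def split: if_splits)
  then have "card {x. x \<in> histories \<and> x 1 = j} = (\<Prod>i\<in>{1..N}. if i = 1 then 1 else k + 1)"
    by (auto simp: card_PiE intro!: prod.cong)
  also have "\<dots> = (\<Prod>i\<in>{1..N} - {1}. k + 1)"
    using N_pos by (subst prod.remove[of _ 1]) auto
  also have "\<dots> = (k + 1) ^ (N - 1)"
    using N_pos by (simp add: card_Diff_singleton)
  finally have "real (card {x. x \<in> histories \<and> x 1 = j}) * (real k + 1) = real (card histories)"
    using N_pos power_minus_mult[of N "real k + 1"] by (simp add: card add.commute)
  then have "1 / (real k + 1) = real (card {x. x \<in> histories \<and> x 1 = j}) / real (card histories)"
    by (simp add: card field_simps)
  moreover have "1 / (real k + 1) < 1"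
    using k_pos by simp
  ultimately have "binary_divergence ((1 / 2) ^ k) (1 / (real k + 1)) - log 2 (card histories)
    \<le> (\<Sum>x\<in>histories. mass z x * log 2 (mass z x))"
    using j half_power_le
    by (intro entropy_deficit[where S = "{x. x \<in> histories \<and> x 1 = j}"])
      (auto simp: mass_nonneg sum_mass intro!: finite_PiE)
  then show ?thesis
    by (simp add: card log_nat_power add.commute)
qed

section \<open>Expected posterior entropy\<close>

lemma posterior_entropy_pair_measurable [measurable]:
  "(\<lambda>(z, u). history_entropy z (answers \<pi> k z u N)) \<in> borel_measurable (borel \<Otimes>\<^sub>M L)"
proof -
  have "(\<lambda>w. \<Sum>x\<in>histories. indicator (C (fst w) x) (snd w) * history_entropy (fst w) x)
    \<in> borel_measurable (borel \<Otimes>\<^sub>M L)"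
    by measurable
  then show ?thesis
    by (simp add: sum_indicator_consistent case_prod_beta)
qed

text \<open>For fixed \<open>z\<close> the integrand is a finite combination of cell indicators. The
  cases used are the identity and, for integrability in \<open>z\<close>, the absolute
  value.\<close>

lemma
  fixes g :: "real \<Rightarrow> real"
  shows integrable_history_entropy:
      "integrable \<Theta> (\<lambda>u. g (history_entropy z (answers \<pi> k z u N)))"
    and integral_history_entropy:
      "(\<integral>u. g (history_entropy z (answers \<pi> k z u N)) \<partial>\<Theta>) =
        (\<Sum>x\<in>histories. mass z x * g (history_entropy z x))"
proof -
  have g: "p0 u * g (history_entropy z (answers \<pi> k z u N)) =
    (\<Sum>x\<in>histories. g (history_entropy z x) * (indicator (C z x) u * p0 u))" for u
  proof -
    have "p0 u * g (history_entropy z (answers \<pi> k z u N)) =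
      (\<Sum>x\<in>histories. indicator (C z x) u * g (history_entropy z x)) * p0 u"
      by (simp add: sum_indicator_consistent)
    then show ?thesis
      unfolding sum_distrib_right by (simp only: mult_ac)
  qed
  have m: "(\<lambda>u. g (history_entropy z (answers \<pi> k z u N))) \<in> borel_measurable L"
    unfolding sum_indicator_consistent[of z _ "\<lambda>x. g (history_entropy z x)", symmetric] by measurable
  show "integrable \<Theta> (\<lambda>u. g (history_entropy z (answers \<pi> k z u N)))"
    using m by (subst integrable_density) (auto simp: p0_nonneg g
      intro!: Bochner_Integration.integrable_sum integrable_mult_right integrable_indicator_times integrable_p0)
  have "(\<integral>u. g (history_entropy z (answers \<pi> k z u N)) \<partial>\<Theta>) =
    (\<integral>u. g (history_entropy z (answers \<pi> k z u N)) * p0 u \<partial>L)"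
    using m by (subst integral_density) (auto simp: p0_nonneg mult.commute)
  also have "\<dots> = (\<Sum>x\<in>histories. g (history_entropy z x) * mass z x)"
    unfolding mass_def by (rule sum_integral_consistent[OF integrable_p0, symmetric])
  finally show "(\<integral>u. g (history_entropy z (answers \<pi> k z u N)) \<partial>\<Theta>) =
        (\<Sum>x\<in>histories. mass z x * g (history_entropy z x))"
    by (simp add: mult.commute)
qed

text \<open>Summing \<open>mass_times_history_entropy\<close> over histories gives the prior entropy
  minus the entropy of the answers.\<close>

lemma expected_entropy_given_z:
  "diff_entropy k p0 + binary_divergence ((1 / 2) ^ k) (1 / (real k + 1)) - real N * log 2 (real k + 1)
    \<le> (\<integral>u. history_entropy z (answers \<pi> k z u N) \<partial>\<Theta>)"
  using mass_entropy_bound[of z] integral_history_entropy[of "\<lambda>y. y" z]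
  by (simp add: mass_times_history_entropy sum_subtractf sum_partial_entropy)

text \<open>Each history costs at most \<open>1 / ln 2\<close> plus its cell's part of the integral
  of \<open>\<bar>p0 * log 2 p0\<bar>\<close>, and these parts add up. The bound is free of
  \<open>z\<close>, as Fubini's theorem requires below.\<close>

lemma expected_abs_entropy_given_z:
  "(\<integral>u. \<bar>history_entropy z (answers \<pi> k z u N)\<bar> \<partial>\<Theta>)
    \<le> real (card histories) / ln 2 + (\<integral>v. \<bar>p0 v * log 2 (p0 v)\<bar> \<partial>L)"
proof -
  have "mass z x * \<bar>history_entropy z x\<bar>
    \<le> 1 / ln 2 + (\<integral>v. indicator (C z x) v * \<bar>p0 v * log 2 (p0 v)\<bar> \<partial>L)" for x
  proof -
    have "mass z x * \<bar>history_entropy z x\<bar> = \<bar>mass z x * log 2 (mass z x) - partial_entropy z x\<bar>"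
      unfolding mass_times_history_entropy[symmetric] by (simp add: abs_mult mass_nonneg)
    also have "\<dots> \<le> \<bar>mass z x * log 2 (mass z x)\<bar> + \<bar>partial_entropy z x\<bar>"
      by (rule abs_triangle_ineq4)
    also have "\<bar>partial_entropy z x\<bar> \<le> (\<integral>v. \<bar>indicator (C z x) v * (p0 v * log 2 (p0 v))\<bar> \<partial>L)"
      unfolding partial_entropy_def by (rule integral_abs_bound)
    also have "\<dots> = (\<integral>v. indicator (C z x) v * \<bar>p0 v * log 2 (p0 v)\<bar> \<partial>L)"
      by (simp add: abs_mult)
    finally show ?thesis
      using abs_mult_log_le[OF mass_nonneg mass_le_1, of z x] by linarith
  qed
  then have "(\<Sum>x\<in>histories. mass z x * \<bar>history_entropy z x\<bar>) \<le>
    (\<Sum>x\<in>histories. 1 / ln 2 + (\<integral>v. indicator (C z x) v * \<bar>p0 v * log 2 (p0 v)\<bar> \<partial>L))"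
    by (intro sum_mono)
  also have "\<dots> = real (card histories) / ln 2 + (\<integral>v. \<bar>p0 v * log 2 (p0 v)\<bar> \<partial>L)"
    using sum_integral_consistent[OF integrable_abs[OF entropy_integrable], of "\<lambda>_. 1" z]
    by (simp add: sum.distrib)
  finally show ?thesis
    by (simp add: integral_history_entropy)
qed

text \<open>The bound holds for every \<open>z\<close>, so it survives averaging over any law
  \<open>U\<close> of Z.\<close>

lemma expected_entropy:
  assumes "prob_space U" and [measurable_cong]: "sets U = sets borel"
  shows "diff_entropy k p0 + binary_divergence ((1 / 2) ^ k) (1 / (real k + 1))
      - real N * log 2 (real k + 1)
    \<le> (\<integral>(z, u). history_entropy z (answers \<pi> k z u N) \<partial>(U \<Otimes>\<^sub>M \<Theta>))"
proof -
  interpret U: prob_space U by fact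
  interpret T: prob_space \<Theta> by (rule prob_space_prior)
  interpret UT: pair_prob_space U \<Theta> ..
  let ?f = "\<lambda>(z, u). history_entropy z (answers \<pi> k z u N)"
  have f [measurable]: "?f \<in> borel_measurable (U \<Otimes>\<^sub>M \<Theta>)"
    by (subst measurable_cong_sets[OF sets_pair_measure_cong[OF assms(2) sets_density] refl]) measurable
  have "integrable U (\<lambda>z. \<integral>u. norm (?f (z, u)) \<partial>\<Theta>)"
  proof (rule U.integrable_const_bound)
    show "AE z in U. norm (\<integral>u. norm (?f (z, u)) \<partial>\<Theta>)
      \<le> real (card histories) / ln 2 + (\<integral>v. \<bar>p0 v * log 2 (p0 v)\<bar> \<partial>L)"
      using expected_abs_entropy_given_z by (intro AE_I2) (simp add: integral_nonneg_AE)
  qed measurable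
  then have int: "integrable (U \<Otimes>\<^sub>M \<Theta>) ?f"
    using integrable_history_entropy[of "\<lambda>y. y"] by (intro UT.Fubini_integrable f) auto
  have "(\<integral>z. diff_entropy k p0 + binary_divergence ((1 / 2) ^ k) (1 / (real k + 1))
      - real N * log 2 (real k + 1) \<partial>U) \<le> (\<integral>z. \<integral>u. ?f (z, u) \<partial>\<Theta> \<partial>U)"
    using UT.integrable_fst'[OF int] expected_entropy_given_z by (intro integral_mono) auto
  then show ?thesis
    using UT.integral_fst'[OF int] by (simp add: U.prob_space)
qed

end

section \<open>Transfer to the random variables and supremum over policies\<close>

theorem theorem1:
  fixes M :: "'a measure"
    and Z :: "'a \<Rightarrow> real"
    and \<theta> :: "nat \<Rightarrow> 'a \<Rightarrow> real"
    and f0 :: "real \<Rightarrow> real"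
    and k N :: nat
  assumes "prob_space M"
    and "k \<ge> 1" and "N \<ge> 1"
    and f0_nonneg: "\<And>t. 0 \<le> f0 t"
    and \<theta>_density: "\<And>i. i \<in> {1..k} \<Longrightarrow> distributed M lborel (\<theta> i) (\<lambda>t. ennreal (f0 t))"
    and \<theta>_indep: "prob_space.indep_vars M (\<lambda>_. borel) \<theta> {1..k}"
    and H0_finite: "integrable (\<Pi>\<^sub>M i\<in>{1..k}. lborel)
          (\<lambda>u. prior_density f0 k u * log 2 (prior_density f0 k u))"
    and Z_uniform: "distributed M lborel Z (indicator {0..1})"
    and Z_indep_\<theta>: "prob_space.indep_set M
          {Z -` A \<inter> space M | A. A \<in> sets borel}
          {(\<lambda>\<omega>. \<lambda>i\<in>{1..k}. \<theta> i \<omega>) -` B \<inter> space M | B. B \<in> sets (\<Pi>\<^sub>M i\<in>{1..k}. borel)}"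
  shows "(SUP \<pi>\<in>policies k N. ereal (reduction_rate M Z \<theta> f0 k \<pi> N)) \<le> ereal (log 2 (real k + 1))
    \<and> (k > 1 \<longrightarrow>
       (SUP \<pi>\<in>policies k N. ereal (reduction_rate M Z \<theta> f0 k \<pi> N)) < ereal (log 2 (real k + 1)))"
proof -
  interpret prob_space M by fact
  \<comment> \<open>The guaranteed loss depends on \<open>k\<close> alone, so a strict gap survives
    the supremum.\<close>
  define \<delta> where "\<delta> = binary_divergence ((1 / 2) ^ k) (1 / (real k + 1))"
  let ?L = "\<Pi>\<^sub>M i\<in>{1..k}. (lborel :: real measure)"
  let ?\<Theta> = "density ?L (\<lambda>u. ennreal (prior_density f0 k u))"
  let ?U = "distr M borel Z"
  let ?\<theta> = "\<lambda>\<omega>. \<lambda>i\<in>{1..k}. \<theta> i \<omega>"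
  have one: "1 \<in> {1..k}"
    using \<open>k \<ge> 1\<close> by simp
  \<comment> \<open>\<open>distributed\<close> speaks only of \<open>ennreal (f0 t)\<close>;
    nonnegativity recovers \<open>f0\<close> from it.\<close>
  have "(\<lambda>t. enn2real (ennreal (f0 t))) \<in> borel_measurable borel"
    using distributed_borel_measurable[OF \<theta>_density[OF one]] by measurable
  then have f0 [measurable]: "f0 \<in> borel_measurable borel"
    by (simp add: f0_nonneg)
  have \<theta>_measurable [measurable]: "\<And>i. i \<in> {1..k} \<Longrightarrow> \<theta> i \<in> borel_measurable M"
    using distributed_measurable[OF \<theta>_density] by simp
  have Z_measurable [measurable]: "Z \<in> borel_measurable M"
    using distributed_measurable[OF Z_uniform] by simp
  have marginal: "distr M borel (\<theta> i) = density lborel (\<lambda>t. ennreal (f0 t))" if "i \<in> {1..k}" for i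
    using distributed_distr_eq_density[OF \<theta>_density[OF that]] by (simp cong: distr_cong)
  have "prob_space (density lborel (\<lambda>t. ennreal (f0 t)))"
    using prob_space_distr[OF \<theta>_measurable[OF one]] by (simp add: marginal[OF one])
  then have f0_int: "(\<integral>\<^sup>+t. ennreal (f0 t) \<partial>lborel) = 1"
    using prob_space.emeasure_space_1 by (fastforce simp: emeasure_density)
  have L_sets [measurable_cong]: "sets ?L = sets (\<Pi>\<^sub>M i\<in>{1..k}. borel)"
    by (intro sets_PiM_cong) auto
  have \<theta>_vec [measurable]: "?\<theta> \<in> M \<rightarrow>\<^sub>M ?L"
    by (intro measurable_restrict) auto
  have "distr M ?L ?\<theta> = distr M (\<Pi>\<^sub>M i\<in>{1..k}. borel) ?\<theta>"
    by (intro distr_cong L_sets) auto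
  also have "\<dots> = (\<Pi>\<^sub>M i\<in>{1..k}. distr M borel (\<theta> i))"
    using \<theta>_indep one by (subst indep_vars_iff_distr_eq_PiM'[symmetric]) auto
  also have "\<dots> = (\<Pi>\<^sub>M i\<in>{1..k}. density lborel (\<lambda>t. ennreal (f0 t)))"
    by (intro PiM_cong marginal refl)
  also have "\<dots> = ?\<Theta>"
    using PiM_density_lborel[OF f0 f0_nonneg f0_int, of "{1..k}"]
    by (simp add: prior_density_def[abs_def])
  finally have \<theta>_law: "distr M ?L ?\<theta> = ?\<Theta>" .
  have U: "prob_space ?U"
    by (rule prob_space_distr) measurable
  have T: "prob_space ?\<Theta>"
    unfolding \<theta>_law[symmetric] by (rule prob_space_distr) measurable
  \<comment> \<open>Independence of Z and \<theta>, checked on rectangles, makes their joint law the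
    product used in \<open>expected_entropy\<close>.\<close>
  have joint: "?U \<Otimes>\<^sub>M ?\<Theta> = distr M (borel \<Otimes>\<^sub>M ?L) (\<lambda>\<omega>. (Z \<omega>, ?\<theta> \<omega>))"
  proof (rule pair_measure_eqI)
    fix A B
    assume A: "A \<in> sets ?U" and B: "B \<in> sets ?\<Theta>"
    have "prob ((Z -` A \<inter> space M) \<inter> (?\<theta> -` B \<inter> space M))
      = prob (Z -` A \<inter> space M) * prob (?\<theta> -` B \<inter> space M)"
      using A B L_sets by (intro indep_setD[OF Z_indep_\<theta>]) auto
    moreover have "emeasure ?\<Theta> B = emeasure M (?\<theta> -` B \<inter> space M)"
      unfolding \<theta>_law[symmetric] using B by (intro emeasure_distr) auto
    moreover have "emeasure (distr M (borel \<Otimes>\<^sub>M ?L) (\<lambda>\<omega>. (Z \<omega>, ?\<theta> \<omega>))) (A \<times> B)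
      = emeasure M ((Z -` A \<inter> space M) \<inter> (?\<theta> -` B \<inter> space M))"
      using A B by (subst emeasure_distr) (auto intro!: arg_cong[where f = "emeasure M"])
    ultimately show "emeasure ?U A * emeasure ?\<Theta> B
      = emeasure (distr M (borel \<Otimes>\<^sub>M ?L) (\<lambda>\<omega>. (Z \<omega>, ?\<theta> \<omega>))) (A \<times> B)"
      using A by (simp add: emeasure_distr emeasure_eq_measure ennreal_mult)
  qed (use U T in \<open>auto intro!: prob_space_imp_sigma_finite sets_pair_measure_cong\<close>)
  have rate: "reduction_rate M Z \<theta> f0 k \<pi> N \<le> log 2 (real k + 1) - \<delta> / real N"
    if \<pi>: "\<pi> \<in> policies k N" for \<pi>
  proof -
    interpret search_policy f0 k N \<pi>
      using assms(2,3) f0_nonneg f0 f0_int H0_finite \<pi> by unfold_locales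
    have "(\<integral>(z, u). history_entropy z (answers \<pi> k z u N) \<partial>(?U \<Otimes>\<^sub>M ?\<Theta>)) =
      expectation (posterior_entropy Z \<theta> f0 \<pi> k N)"
      unfolding joint using posterior_entropy_pair_measurable
      by (subst integral_distr) (auto simp: posterior_entropy_def[abs_def] history_entropy_def)
    moreover have "diff_entropy k (prior_density f0 k) + \<delta> - real N * log 2 (real k + 1)
      \<le> (\<integral>(z, u). history_entropy z (answers \<pi> k z u N) \<partial>(?U \<Otimes>\<^sub>M ?\<Theta>))"
      unfolding \<delta>_def by (rule expected_entropy[OF U]) simp
    ultimately have "reduction_rate M Z \<theta> f0 k \<pi> N \<le> (real N * log 2 (real k + 1) - \<delta>) / real N"
      unfolding reduction_rate_def by (intro divide_right_mono) auto
    then show ?thesis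
      using \<open>N \<ge> 1\<close> by (simp add: diff_divide_distrib)
  qed
  have sup: "(SUP \<pi>\<in>policies k N. ereal (reduction_rate M Z \<theta> f0 k \<pi> N))
    \<le> ereal (log 2 (real k + 1) - \<delta> / real N)"
    by (intro SUP_least) (simp add: rate)
  have strict: "0 < \<delta>" if "k > 1"
  proof -
    have "real k + 1 < 2 ^ k"
    proof -
      have "Suc k < 2 ^ k"
        by (rule Suc_less_two_power) (use that in simp)
      then show ?thesis
        by (metis add.commute of_nat_Suc of_nat_less_iff of_nat_numeral of_nat_power)
    qed
    then show ?thesis
      unfolding \<delta>_def using that
      by (intro binary_divergence_pos) (auto simp: power_divide frac_less2)
  qed
  have "0 \<le> \<delta>"
  \<comment> \<open>For \<open>k = 1\<close> both parameters of the divergence are 1/2, and it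
    vanishes.\<close>
  proof (cases "k > 1")
    case False
    then have "k = 1"
      using \<open>k \<ge> 1\<close> by simp
    then show ?thesis
      by (simp add: \<delta>_def binary_divergence_self)
  qed (use strict in force)
  then have "log 2 (real k + 1) - \<delta> / real N \<le> log 2 (real k + 1)"
    by simp
  moreover have "log 2 (real k + 1) - \<delta> / real N < log 2 (real k + 1)" if "k > 1"
    using strict[OF that] \<open>N \<ge> 1\<close> by simp
  ultimately show ?thesis
    using sup by (meson ereal_less_eq(3) less_ereal.simps(1) order_trans order_le_less_trans)
qed

end
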